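(* There is an absolute constant $C>0$ such that for all positive integers $n$ and $k$, $$\mathrm{bp}_{1.5}\bigl(K_{n^{2k-1}}\bigr)\le C\,k\,n^{k},$$ where $K_{n^{2k-1}}$ is the complete graph on $n^{2k-1}$ vertices.
   Context: For disjoint vertex sets $U,W$, the biclique $\mathcal{B}(U,W)$ is the complete bipartite graph with edge set $\{\{u,w\}: u\in U, w\in W\}$; $U$ is its first class and $W$ its second class. An ordered biclique partition of a graph $G=(V,E)$ is a collection of bicliques $\{\mathcal{B}(U_i,W_i)\}_i$ with $U_i,W_i\subseteq V$ disjoint, each of whose edges is an edge of $G$, such that (i) every edge of $G$ lies in at least one and at most two bicliques of the collection, and (ii) if an edge $e=\{u,v\}$ lies in two bicliques $\mathcal{B}(U_k,W_k)$ and $\mathcal{B}(U_\ell,W_\ell)$, then for each endpoint $w\in\{u,v\}$ we have $w\in U_k\cap W_\ell$ or $w\in U_\ell\cap W_k$. $\mathrm{bp}_{1.5}(G)$ denotes the minimum size of an ordered biclique partition of $G$. *)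

theory Defs
  imports Complex_Main "HOL-Library.Ramsey"
begin

definition biclique_edges :: "'a set \<Rightarrow> 'a set \<Rightarrow> 'a set set" where
  "biclique_edges U W = {{u, w} | u w. u \<in> U \<and> w \<in> W}"

text \<open>A graph is a pair of a vertex set and a set of two-element edges. A collection of bicliques
  with ordered classes is a finite family, given as the list of the pairs \<open>(U\<^sub>i, W\<^sub>i)\<close>; in
  particular \<open>(U, W)\<close> and \<open>(W, U)\<close> are different members.\<close>

definition ordered_biclique_partition ::
    "'a set \<times> 'a set set \<Rightarrow> ('a set \<times> 'a set) list \<Rightarrow> bool" where
  "ordered_biclique_partition G Bs \<longleftrightarrow>
     (\<forall>(U, W) \<in> set Bs. U \<subseteq> fst G \<and> W \<subseteq> fst G \<and> U \<inter> W = {} \<and> biclique_edges U W \<subseteq> snd G) \<and>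
     (\<forall>e \<in> snd G.
        1 \<le> card {i. i < length Bs \<and> e \<in> biclique_edges (fst (Bs ! i)) (snd (Bs ! i))} \<and>
        card {i. i < length Bs \<and> e \<in> biclique_edges (fst (Bs ! i)) (snd (Bs ! i))} \<le> 2) \<and>
     (\<forall>e \<in> snd G. \<forall>k < length Bs. \<forall>l < length Bs. k \<noteq> l \<longrightarrow>
        e \<in> biclique_edges (fst (Bs ! k)) (snd (Bs ! k)) \<longrightarrow>
        e \<in> biclique_edges (fst (Bs ! l)) (snd (Bs ! l)) \<longrightarrow>
        (\<forall>w \<in> e. w \<in> fst (Bs ! k) \<inter> snd (Bs ! l) \<or> w \<in> fst (Bs ! l) \<inter> snd (Bs ! k)))"

definition bp15 :: "'a set \<times> 'a set set \<Rightarrow> nat" where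
  "bp15 G = (LEAST m. \<exists>Bs. ordered_biclique_partition G Bs \<and> length Bs = m)"

definition complete_graph :: "nat \<Rightarrow> nat set \<times> nat set set" where
  "complete_graph N = ({..<N}, nsets {..<N} 2)"

text \<open>Every finite simple graph has an ordered biclique partition (one biclique per edge), so the
  minimum in \<open>bp15\<close> is attained.\<close>

lemma ordered_biclique_partition_exists:
  assumes "finite V" and E: "E \<subseteq> nsets V 2"
  shows "\<exists>Bs. ordered_biclique_partition (V, E) Bs"
proof -
  have "finite E"
    using assms finite_imp_finite_nsets finite_subset by blast
  then obtain es where es: "set es = E" "distinct es"
    using finite_distinct_list by blast
  have "\<forall>e\<in>E. \<exists>p. fst p \<noteq> snd p \<and> e = {fst p, snd p}"
  proof
    fix e assume "e \<in> E"
    then have "card e = 2"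
      using E by (auto simp: nsets_def)
    then show "\<exists>p. fst p \<noteq> snd p \<and> e = {fst p, snd p}"
      by (auto simp: card_2_iff)
  qed
  then obtain p where p: "\<And>e. e \<in> E \<Longrightarrow> fst (p e) \<noteq> snd (p e) \<and> e = {fst (p e), snd (p e)}"
    by metis
  define f where "f e = ({fst (p e)}, {snd (p e)})" for e
  have be: "biclique_edges (fst (f e)) (snd (f e)) = {e}" if "e \<in> E" for e
    using p[OF that] by (auto simp: f_def biclique_edges_def)
  have nth: "biclique_edges (fst (map f es ! i)) (snd (map f es ! i)) = {es ! i}"
    if "i < length es" for i
    using be[of "es ! i"] that es(1) nth_mem by fastforce
  have one: "\<exists>i. {i. i < length es \<and> e \<in> biclique_edges (fst (map f es ! i)) (snd (map f es ! i))} = {i}"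
    if e: "e \<in> E" for e
  proof -
    obtain i where i: "i < length es" "es ! i = e"
      using e es(1) by (metis in_set_conv_nth)
    have "{j. j < length es \<and> e \<in> biclique_edges (fst (map f es ! j)) (snd (map f es ! j))} = {i}"
      using i nth es(2) by (auto simp: nth_eq_iff_index_eq simp del: nth_map)
    then show ?thesis by blast
  qed
  have cl: "U \<subseteq> V \<and> W \<subseteq> V \<and> U \<inter> W = {} \<and> biclique_edges U W \<subseteq> E"
    if UW: "(U, W) \<in> set (map f es)" for U W
  proof -
    obtain e where e: "e \<in> E" "f e = (U, W)"
      using UW es(1) by auto
    have "e \<subseteq> V"
      using e(1) E by (auto simp: nsets_def)
    then have "fst (p e) \<in> V" "snd (p e) \<in> V"
      using p[OF e(1)] by blast+
    then show ?thesis
      using be[OF e(1)] e p[OF e(1)] by (auto simp: f_def)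
  qed
  have "ordered_biclique_partition (V, E) (map f es)"
    unfolding ordered_biclique_partition_def
  proof (intro conjI ballI allI impI; (unfold fst_conv snd_conv length_map)?)
    fix x assume "x \<in> set (map f es)"
    then show "case x of (U, W) \<Rightarrow> U \<subseteq> V \<and> W \<subseteq> V \<and> U \<inter> W = {} \<and> biclique_edges U W \<subseteq> E"
      using cl[of "fst x" "snd x"] unfolding case_prod_beta prod.collapse by blast
  next
    fix e assume "e \<in> E"
    then show "1 \<le> card {i. i < length es \<and> e \<in> biclique_edges (fst (map f es ! i)) (snd (map f es ! i))}"
      using one[of e] by (metis (no_types, lifting) is_singletonI is_singleton_altdef order_refl)
  next
    fix e assume "e \<in> E"
    then show "card {i. i < length es \<and> e \<in> biclique_edges (fst (map f es ! i)) (snd (map f es ! i))} \<le> 2"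
      using one[of e] by (metis (no_types, lifting) is_singletonI is_singleton_altdef one_le_numeral)
  next
    fix e k l w
    assume "k < length es" "l < length es" "k \<noteq> l"
      "e \<in> biclique_edges (fst (map f es ! k)) (snd (map f es ! k))"
      "e \<in> biclique_edges (fst (map f es ! l)) (snd (map f es ! l))"
    then have "es ! k = es ! l"
      unfolding nth[OF \<open>k < length es\<close>] nth[OF \<open>l < length es\<close>] by blast
    then have False
      using \<open>k < length es\<close> \<open>l < length es\<close> \<open>k \<noteq> l\<close> es(2) by (simp add: nth_eq_iff_index_eq)
    then show "w \<in> fst (map f es ! k) \<inter> snd (map f es ! l) \<or> w \<in> fst (map f es ! l) \<inter> snd (map f es ! k)" ..
  qed
  then show ?thesis by blast
qed

end

theory Submission
  imports Defs
begin

text \<open>An ordered biclique partition of a complete graph on \<open>V\<close> is a family of rectangles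
  \<open>U \<times> W \<subseteq> V \<times> V\<close>, pairwise disjoint and off the diagonal, which for all \<open>u \<noteq> v\<close> cover
  \<open>(u, v)\<close> or \<open>(v, u)\<close>.

  Put \<open>q = k - 1\<close> and write a vertex as \<open>(a, y)\<close> with \<open>a < n\<^sup>q\<close> and \<open>y < n\<^sup>k\<close>, both read in base
  \<open>n\<close>. There are \<open>2 k - 1\<close> relations between vertices. For \<open>j \<le> q\<close>, \<open>F\<^sub>j\<close> says that \<open>j\<close> is the
  lowest digit where \<open>y\<close> and \<open>y'\<close> differ, and that \<open>(a, y)\<close> is lexicographically smaller than
  \<open>(a', y')\<close> when only the \<open>q - j\<close> lowest digits of \<open>a\<close> and the \<open>j + 1\<close> lowest digits of \<open>y\<close> are
  kept. For \<open>p < q\<close>, \<open>G\<^sub>p\<close> says that \<open>p\<close> is the highest digit where \<open>a\<close> and \<open>a'\<close> differ, that \<open>a\<close>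
  is the larger one, and that \<open>y\<close> and \<open>y'\<close> agree from digit \<open>q - p\<close> upwards. Each relation sees
  only \<open>k\<close> digits of each vertex, hence splits into at most \<open>n\<^sup>k\<close> rectangles, one for each value
  of these digits in the first vertex.

  The relations are disjoint. In the critical case, \<open>F\<^sub>j\<close> against \<open>G\<^sub>p\<close>: if \<open>j \<ge> q - p\<close>, then
  \<open>G\<^sub>p\<close> makes \<open>y\<close> and \<open>y'\<close> agree at digit \<open>j\<close>; if \<open>j < q - p\<close>, then \<open>F\<^sub>j\<close> sees digit \<open>p\<close> of
  \<open>a\<close>, and the two relations order \<open>a\<close> and \<open>a'\<close> in opposite ways.\<close>

section \<open>Families of rectangles as ordered biclique partitions\<close>

lemma ordered_biclique_partition_complete:
  assumes sub: "\<And>i. i < length Bs \<Longrightarrow> fst (Bs ! i) \<subseteq> V \<and> snd (Bs ! i) \<subseteq> V"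
    and disj: "\<And>i. i < length Bs \<Longrightarrow> fst (Bs ! i) \<inter> snd (Bs ! i) = {}"
    and uniq: "\<And>i j u v. \<lbrakk>i < length Bs; j < length Bs; u \<in> fst (Bs ! i); v \<in> snd (Bs ! i);
                 u \<in> fst (Bs ! j); v \<in> snd (Bs ! j)\<rbrakk> \<Longrightarrow> i = j"
    and cover: "\<And>u v. \<lbrakk>u \<in> V; v \<in> V; u \<noteq> v\<rbrakk> \<Longrightarrow> \<exists>i < length Bs.
                 u \<in> fst (Bs ! i) \<and> v \<in> snd (Bs ! i) \<or> v \<in> fst (Bs ! i) \<and> u \<in> snd (Bs ! i)"
  shows "ordered_biclique_partition (V, nsets V 2) Bs"
proof -
  define D where "D u v = {i. i < length Bs \<and> u \<in> fst (Bs ! i) \<and> v \<in> snd (Bs ! i)}" for u v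
  have D_le: "card (D u v) \<le> 1" for u v
    using uniq by (intro card_le_Suc0_iff_eq[THEN iffD2, folded One_nat_def]) (auto simp: D_def)
  have be: "{u, v} \<in> biclique_edges U W \<longleftrightarrow> u \<in> U \<and> v \<in> W \<or> v \<in> U \<and> u \<in> W"
    for u v :: 'a and U W
    by (auto simp: biclique_edges_def doubleton_eq_iff)
  \<comment> \<open>The bicliques through an edge come from its two orientations. Each orientation
    lies in at most one rectangle by \<open>D_le\<close>, hence the bound 2.\<close>
  have idx: "{i. i < length Bs \<and> {u, v} \<in> biclique_edges (fst (Bs ! i)) (snd (Bs ! i))}
      = D u v \<union> D v u" for u v
    by (auto simp: be D_def)
  have edge: "\<exists>u v. e = {u, v} \<and> u \<in> V \<and> v \<in> V \<and> u \<noteq> v" if "e \<in> nsets V 2" for e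
    using that by (auto simp: nsets_def card_2_iff)
  show ?thesis
    unfolding ordered_biclique_partition_def fst_conv snd_conv
  proof (intro conjI ballI allI impI)
    fix x assume "x \<in> set Bs"
    then obtain i where i: "i < length Bs" "x = Bs ! i"
      by (auto simp: in_set_conv_nth)
    have "biclique_edges (fst x) (snd x) \<subseteq> nsets V 2"
    proof
      fix e assume "e \<in> biclique_edges (fst x) (snd x)"
      then obtain u w where "e = {u, w}" "u \<in> fst x" "w \<in> snd x"
        by (auto simp: biclique_edges_def)
      moreover from this have "u \<noteq> w"
        using disj[OF i(1)] i(2) by blast
      ultimately show "e \<in> nsets V 2"
        using sub[OF i(1)] i(2) by (auto simp: nsets_def)
    qed
    then show "case x of (U, W) \<Rightarrow> U \<subseteq> V \<and> W \<subseteq> V \<and> U \<inter> W = {} \<and> biclique_edges U W \<subseteq> nsets V 2"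
      using sub[OF i(1)] disj[OF i(1)] i(2) by (simp add: case_prod_beta)
  next
    fix e assume "e \<in> nsets V 2"
    then obtain u v where e: "e = {u, v}" "u \<in> V" "v \<in> V" "u \<noteq> v"
      using edge by blast
    have "finite (D u v \<union> D v u)"
      by (simp add: D_def)
    moreover have "D u v \<union> D v u \<noteq> {}"
      using cover[OF e(2-4)] by (auto simp: D_def)
    ultimately have "card (D u v \<union> D v u) \<ge> 1"
      by (simp add: Suc_le_eq card_gt_0_iff)
    then show "1 \<le> card {i. i < length Bs \<and> e \<in> biclique_edges (fst (Bs ! i)) (snd (Bs ! i))}"
      by (simp only: e(1) idx)
    show "card {i. i < length Bs \<and> e \<in> biclique_edges (fst (Bs ! i)) (snd (Bs ! i))} \<le> 2"
      unfolding e(1) idx using card_Un_le[of "D u v" "D v u"] D_le[of u v] D_le[of v u] by linarith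
  next
    fix e i j w
    assume ij: "e \<in> nsets V 2" "i < length Bs" "j < length Bs" "i \<noteq> j"
      "e \<in> biclique_edges (fst (Bs ! i)) (snd (Bs ! i))"
      "e \<in> biclique_edges (fst (Bs ! j)) (snd (Bs ! j))" "w \<in> e"
    then obtain u v where e: "e = {u, v}"
      using edge by blast
    \<comment> \<open>By \<open>uniq\<close>, two distinct bicliques sharing the edge contain it in
      opposite orientations, so each endpoint is in the first class of one and the second class of
      the other.\<close>
    show "w \<in> fst (Bs ! i) \<inter> snd (Bs ! j) \<or> w \<in> fst (Bs ! j) \<inter> snd (Bs ! i)"
      using ij(5-7) uniq[OF ij(2,3), of u v] uniq[OF ij(2,3), of v u] ij(4)
      unfolding e be by blast
  qed
qed

lemma bp15_le_card_rectangles: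
  assumes "finite I"
    and sub: "\<And>i. i \<in> I \<Longrightarrow> U i \<subseteq> V \<and> W i \<subseteq> V"
    and disj: "\<And>i. i \<in> I \<Longrightarrow> U i \<inter> W i = {}"
    and uniq: "\<And>i j u v. \<lbrakk>i \<in> I; j \<in> I; u \<in> U i; v \<in> W i; u \<in> U j; v \<in> W j\<rbrakk> \<Longrightarrow> i = j"
    and cover: "\<And>u v. \<lbrakk>u \<in> V; v \<in> V; u \<noteq> v\<rbrakk> \<Longrightarrow> \<exists>i\<in>I. u \<in> U i \<and> v \<in> W i \<or> v \<in> U i \<and> u \<in> W i"
  shows "bp15 (V, nsets V 2) \<le> card I"
proof -
  obtain xs where xs: "set xs = I" "distinct xs"
    using \<open>finite I\<close> finite_distinct_list by blast
  let ?Bs = "map (\<lambda>i. (U i, W i)) xs"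
  have mem: "xs ! i \<in> I" if "i < length xs" for i
    using that xs(1) nth_mem by blast
  have "ordered_biclique_partition (V, nsets V 2) ?Bs"
  proof (rule ordered_biclique_partition_complete)
    fix i assume "i < length ?Bs"
    then show "fst (?Bs ! i) \<subseteq> V \<and> snd (?Bs ! i) \<subseteq> V" "fst (?Bs ! i) \<inter> snd (?Bs ! i) = {}"
      using sub disj mem by simp_all
  next
    fix i j u v
    assume ij: "i < length ?Bs" "j < length ?Bs" and
      "u \<in> fst (?Bs ! i)" "v \<in> snd (?Bs ! i)" "u \<in> fst (?Bs ! j)" "v \<in> snd (?Bs ! j)"
    then have "xs ! i = xs ! j"
      using uniq[OF mem mem] by simp
    then show "i = j"
      using ij xs(2) by (simp add: nth_eq_iff_index_eq)
  next
    fix u v assume "u \<in> V" "v \<in> V" "u \<noteq> v"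
    then obtain x where "x \<in> I" "u \<in> U x \<and> v \<in> W x \<or> v \<in> U x \<and> u \<in> W x"
      using cover by blast
    moreover from \<open>x \<in> I\<close> obtain i where "i < length xs" "xs ! i = x"
      using xs(1) by (metis in_set_conv_nth)
    ultimately show "\<exists>i < length ?Bs.
        u \<in> fst (?Bs ! i) \<and> v \<in> snd (?Bs ! i) \<or> v \<in> fst (?Bs ! i) \<and> u \<in> snd (?Bs ! i)"
      by (intro exI[of _ i]) auto
  qed
  moreover have "length ?Bs = card I"
    using xs distinct_card by fastforce
  ultimately show ?thesis
    unfolding bp15_def by (intro Least_le) blast
qed

text \<open>A relation that depends only on labels is a union of rectangles, each the fibre of a
  label times everything related to that label. Irreflexivity is asked of labels rather than
  vertices, since the whole fibre must stay out of the second class.\<close>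

lemma bp15_le_labelled_relations:
  fixes lab :: "'t \<Rightarrow> 'a \<Rightarrow> 'l" and R :: "'t \<Rightarrow> 'l \<Rightarrow> 'l \<Rightarrow> bool"
  assumes fin: "finite T" "finite V"
    and labels: "\<And>t. t \<in> T \<Longrightarrow> card (lab t ` V) \<le> m"
    and irrefl: "\<And>t x. t \<in> T \<Longrightarrow> \<not> R t x x"
    and uniq: "\<And>s t u v. \<lbrakk>s \<in> T; t \<in> T; u \<in> V; v \<in> V;
                 R s (lab s u) (lab s v); R t (lab t u) (lab t v)\<rbrakk> \<Longrightarrow> s = t"
    and cover: "\<And>u v. \<lbrakk>u \<in> V; v \<in> V; u \<noteq> v\<rbrakk> \<Longrightarrow>
                 \<exists>t\<in>T. R t (lab t u) (lab t v) \<or> R t (lab t v) (lab t u)"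
  shows "bp15 (V, nsets V 2) \<le> card T * m"
proof -
  define I where "I = (SIGMA t:T. lab t ` V)"
  define U where "U = (\<lambda>(t, l). {u \<in> V. lab t u = l})"
  define W where "W = (\<lambda>(t, l). {v \<in> V. R t l (lab t v)})"
  have "bp15 (V, nsets V 2) \<le> card I"
  proof (rule bp15_le_card_rectangles[of I U V W])
    show "finite I"
      using fin by (auto simp: I_def)
    show "U i \<subseteq> V \<and> W i \<subseteq> V" for i
      by (auto simp: U_def W_def split: prod.splits)
    show "U i \<inter> W i = {}" if "i \<in> I" for i
      using that irrefl by (auto simp: U_def W_def I_def)
    show "i = j" if "i \<in> I" "j \<in> I" "u \<in> U i" "v \<in> W i" "u \<in> U j" "v \<in> W j" for i j u v
      using that uniq[of "fst i" "fst j" u v] by (auto simp: U_def W_def I_def)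
    show "\<exists>i\<in>I. u \<in> U i \<and> v \<in> W i \<or> v \<in> U i \<and> u \<in> W i"
      if uv: "u \<in> V" "v \<in> V" "u \<noteq> v" for u v
    proof -
      obtain t where "t \<in> T" "R t (lab t u) (lab t v) \<or> R t (lab t v) (lab t u)"
        using cover[OF uv] by blast
      then show ?thesis
        using uv by (auto simp: U_def W_def I_def intro!: bexI[of _ "(t, lab t u)"] bexI[of _ "(t, lab t v)"])
    qed
  qed
  also have "card I = (\<Sum>t\<in>T. card (lab t ` V))"
    unfolding I_def using fin by (intro card_SigmaI) auto
  also have "\<dots> \<le> card T * m"
    using sum_bounded_above[of T "\<lambda>t. card (lab t ` V)" m] labels by simp
  finally show ?thesis .
qed

section \<open>Comparing digits in base \<open>b\<close>\<close>

lemma mod_power_eq_mono: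
  fixes x y b :: nat
  assumes "x mod b ^ j = y mod b ^ j" "i \<le> j"
  shows "x mod b ^ i = y mod b ^ i"
  using assms by (metis le_imp_power_dvd mod_mod_cancel)

lemma div_power_eq_mono:
  fixes x y b :: nat
  assumes "x div b ^ i = y div b ^ i" "i \<le> j"
  shows "x div b ^ j = y div b ^ j"
  using assms by (metis div_mult2_eq le_add_diff_inverse power_add)

lemma lowest_differing_digit:
  fixes x y b :: nat
  assumes "x \<noteq> y" "x < b ^ Suc q" "y < b ^ Suc q"
  shows "\<exists>j\<le>q. x mod b ^ j = y mod b ^ j \<and> x mod b ^ Suc j \<noteq> y mod b ^ Suc j"
proof -
  let ?P = "\<lambda>j. x mod b ^ Suc j \<noteq> y mod b ^ Suc j"
  have q: "?P q"
    using assms by simp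
  define j where "j = (LEAST j. ?P j)"
  have "?P j" "j \<le> q"
    unfolding j_def using q by (rule LeastI, intro Least_le)
  \<comment> \<open>Minimality of \<open>j\<close> gives this for positive \<open>j\<close>; for
    \<open>j = 0\<close> the modulus is 1.\<close>
  moreover have "x mod b ^ j = y mod b ^ j"
  proof (cases j)
    case (Suc i)
    then show ?thesis
      using not_less_Least[of i ?P] by (auto simp: j_def)
  qed simp
  ultimately show ?thesis by blast
qed

lemma highest_differing_digit:
  fixes x y b :: nat
  assumes "x \<noteq> y" "x < b ^ q" "y < b ^ q"
  shows "\<exists>p<q. x div b ^ Suc p = y div b ^ Suc p \<and> x div b ^ p \<noteq> y div b ^ p"
proof -
  let ?P = "\<lambda>p. x div b ^ Suc p = y div b ^ Suc p"
  have "q \<noteq> 0"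
    using assms by (cases q) auto
  then have q: "?P (q - 1)"
    using assms by (simp del: power_Suc)
  \<comment> \<open>Agreement above position \<open>p\<close> persists for larger \<open>p\<close>,
    so the least such \<open>p\<close> is the highest differing digit.\<close>
  define p where "p = (LEAST p. ?P p)"
  have "?P p" "p \<le> q - 1"
    unfolding p_def using q by (rule LeastI, intro Least_le)
  moreover have "x div b ^ p \<noteq> y div b ^ p"
  proof (cases p)
    case 0
    then show ?thesis
      using \<open>x \<noteq> y\<close> by simp
  next
    case (Suc i)
    then show ?thesis
      using not_less_Least[of i ?P] by (auto simp: p_def)
  qed
  ultimately show ?thesis
    using \<open>q \<noteq> 0\<close> by (intro exI[of _ p]) auto
qed

section \<open>The relations \<open>F\<^sub>j\<close> and \<open>G\<^sub>p\<close>\<close>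

lemma bp15_complete_graph_le:
  fixes n q :: nat
  assumes "n \<ge> 1"
  shows "bp15 (complete_graph (n ^ (2 * q + 1))) \<le> (2 * q + 1) * n ^ Suc q"
proof -
  define A where "A u = u mod n ^ q" for u
  define Y where "Y u = u div n ^ q" for u
  \<comment> \<open>\<open>Inl j\<close> encodes \<open>F\<^sub>j\<close> and \<open>Inr p\<close>
    encodes \<open>G\<^sub>p\<close>. As \<open>A u\<close> has \<open>q\<close> digits and
    \<open>Y u\<close> has \<open>q + 1\<close>, the labels keep \<open>(q - j) + (j + 1)\<close>
    and \<open>(q - p) + (p + 1)\<close> digits, in both cases \<open>q + 1\<close>.\<close>
  define lab :: "nat + nat \<Rightarrow> nat \<Rightarrow> nat \<times> nat" where
    "lab t u = (case t of Inl j \<Rightarrow> (A u mod n ^ (q - j), Y u mod n ^ Suc j)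
                        | Inr p \<Rightarrow> (A u div n ^ p, Y u div n ^ (q - p)))" for t u
  define R :: "nat + nat \<Rightarrow> nat \<times> nat \<Rightarrow> nat \<times> nat \<Rightarrow> bool" where
    "R t l l' = (case t of
         Inl j \<Rightarrow> snd l mod n ^ j = snd l' mod n ^ j \<and> snd l \<noteq> snd l' \<and>
                  (fst l < fst l' \<or> fst l = fst l' \<and> snd l < snd l')
       | Inr p \<Rightarrow> snd l = snd l' \<and> fst l div n = fst l' div n \<and> fst l > fst l')" for t l l'
  have RF: "R (Inl j) (lab (Inl j) u) (lab (Inl j) v) \<longleftrightarrow>
      Y u mod n ^ j = Y v mod n ^ j \<and> Y u mod n ^ Suc j \<noteq> Y v mod n ^ Suc j \<and>
      (A u mod n ^ (q - j) < A v mod n ^ (q - j) \<or>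
       A u mod n ^ (q - j) = A v mod n ^ (q - j) \<and> Y u mod n ^ Suc j < Y v mod n ^ Suc j)" for j u v
    by (simp add: R_def lab_def mod_mod_cancel del: power_Suc)
       (simp add: mod_mod_cancel)
  have RG: "R (Inr p) (lab (Inr p) u) (lab (Inr p) v) \<longleftrightarrow>
      Y u div n ^ (q - p) = Y v div n ^ (q - p) \<and> A u div n ^ Suc p = A v div n ^ Suc p \<and>
      A u div n ^ p > A v div n ^ p" for p u v
    by (simp add: R_def lab_def flip: div_mult2_eq) (simp add: mult.commute)
  define V where "V = {..<n ^ (2 * q + 1)}"
  define T :: "(nat + nat) set" where "T = {..q} <+> {..<q}"
  have A_less: "A u < n ^ q" for u
    using assms by (simp add: A_def)
  have Y_less: "Y u < n ^ Suc q" if "u \<in> V" for u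
    using that assms by (simp add: V_def Y_def less_mult_imp_div_less mult_2 power_add mult.assoc)
  have FG: False if F: "R (Inl j) (lab (Inl j) u) (lab (Inl j) v)"
    and G: "R (Inr p) (lab (Inr p) u) (lab (Inr p) v)" and "p < q" for j p u v
  proof (cases "q - p \<le> j")
    case True
    then have "Y u mod n ^ (q - p) = Y v mod n ^ (q - p)"
      using F mod_power_eq_mono unfolding RF by blast
    then have "Y u = Y v"
      using G unfolding RG by (metis div_mult_mod_eq)
    then show False
      using F unfolding RF by simp
  next
    case False
    then have "Suc p \<le> q - j"
      using \<open>p < q\<close> by simp
    then have "A u div n ^ (q - j) = A v div n ^ (q - j)"
      using G div_power_eq_mono unfolding RG by blast
    moreover have "A u > A v"
      using G unfolding RG by (meson div_le_mono leD leI)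
    \<comment> \<open>With equal quotients, the order of \<open>A u\<close> and \<open>A v\<close>
      is that of their residues.\<close>
    ultimately have "A u mod n ^ (q - j) > A v mod n ^ (q - j)"
      by (metis div_mult_mod_eq nat_add_left_cancel_less)
    then show False
      using F unfolding RF by linarith
  qed
  \<comment> \<open>If \<open>j < j'\<close>, the second relation forces agreement modulo
    \<open>n ^ Suc j\<close>, which the first forbids; \<open>GG\<close> is dual.\<close>
  have FF: "j = j'" if "R (Inl j) (lab (Inl j) u) (lab (Inl j) v)"
    "R (Inl j') (lab (Inl j') u) (lab (Inl j') v)" for j j' u v
    using that mod_power_eq_mono[of "Y u" n _ "Y v"] unfolding RF
    by (metis Suc_leI linorder_neqE_nat)
  have GG: "p = p'" if "R (Inr p) (lab (Inr p) u) (lab (Inr p) v)"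
    "R (Inr p') (lab (Inr p') u) (lab (Inr p') v)" for p p' u v
    using that div_power_eq_mono[of "A u" n _ "A v"] unfolding RG
    by (metis Suc_leI linorder_neqE_nat less_irrefl)
  have "bp15 (V, nsets V 2) \<le> card T * n ^ Suc q"
  proof (rule bp15_le_labelled_relations[where lab = lab and R = R])
    show "finite T" "finite V"
      by (simp_all add: T_def V_def)
    show "card (lab t ` V) \<le> n ^ Suc q" if "t \<in> T" for t
    proof -
      obtain b c where bc: "lab t ` V \<subseteq> {..<n ^ b} \<times> {..<n ^ c}" "b + c = Suc q"
      proof (cases t)
        case (Inl j)
        have "lab t ` V \<subseteq> {..<n ^ (q - j)} \<times> {..<n ^ Suc j}"
          using assms by (auto simp: lab_def Inl simp del: power_Suc)
        moreover have "q - j + Suc j = Suc q"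
          using \<open>t \<in> T\<close> Inl by (auto simp: T_def)
        ultimately show ?thesis
          by (rule that)
      next
        case (Inr p)
        have p: "p < q"
          using \<open>t \<in> T\<close> Inr by (auto simp: T_def)
        have "n ^ (q - p) * n ^ p = n ^ q" "n ^ Suc p * n ^ (q - p) = n ^ Suc q"
          using p by (simp_all flip: power_add power_Suc)
        then have "lab t ` V \<subseteq> {..<n ^ (q - p)} \<times> {..<n ^ Suc p}"
          using A_less Y_less
          by (auto simp: lab_def Inr simp del: power_Suc intro!: less_mult_imp_div_less)
        moreover have "q - p + Suc p = Suc q"
          using p by simp
        ultimately show ?thesis
          by (rule that)
      qed
      have "card (lab t ` V) \<le> card ({..<n ^ b} \<times> {..<n ^ c})"
        using bc(1) by (intro card_mono) auto
      also have "\<dots> = n ^ Suc q"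
        using bc(2) by (simp flip: power_add)
      finally show ?thesis .
    qed
    show "\<not> R t x x" for t x
      by (auto simp: R_def split: sum.splits)
    show "s = t" if "s \<in> T" "t \<in> T" "R s (lab s u) (lab s v)" "R t (lab t u) (lab t v)" for s t u v
      using that FF GG FG by (cases s; cases t) (auto simp: T_def)
    show "\<exists>t\<in>T. R t (lab t u) (lab t v) \<or> R t (lab t v) (lab t u)"
      if "u \<in> V" "v \<in> V" "u \<noteq> v" for u v
    proof (cases "Y u = Y v")
      case False
      then obtain j where "j \<le> q" "Y u mod n ^ j = Y v mod n ^ j" "Y u mod n ^ Suc j \<noteq> Y v mod n ^ Suc j"
        using lowest_differing_digit[OF _ Y_less Y_less] \<open>u \<in> V\<close> \<open>v \<in> V\<close> by blast
      \<comment> \<open>The two labels differ in their second components, and the lexicographic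
        order is total, so one direction holds.\<close>
      then show ?thesis
        by (intro bexI[of _ "Inl j"]) (auto simp: RF T_def simp del: power_Suc)
    next
      case True
      then have "A u \<noteq> A v"
        using \<open>u \<noteq> v\<close> unfolding A_def Y_def by (metis div_mult_mod_eq)
      then obtain p where "p < q" "A u div n ^ Suc p = A v div n ^ Suc p" "A u div n ^ p \<noteq> A v div n ^ p"
        using highest_differing_digit[OF _ A_less A_less] by blast
      then show ?thesis
        using True by (intro bexI[of _ "Inr p"]) (auto simp: RG T_def simp del: power_Suc)
    qed
  qed
  moreover have "card T = 2 * q + 1"
    by (simp add: T_def card_Plus)
  ultimately show ?thesis
    by (simp add: complete_graph_def V_def)
qed

theorem theorem1:
  shows "\<exists>C::real. C > 0 \<and> (\<forall>n k :: nat. n \<ge> 1 \<longrightarrow> k \<ge> 1 \<longrightarrow>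
           real (bp15 (complete_graph (n ^ (2 * k - 1)))) \<le> C * real k * real n ^ k)"
\<comment> \<open>The constant 2 comes from the number \<open>2 * q + 1 = 2 * k - 1\<close> of
  relations.\<close>
proof (intro exI[of _ 2] conjI allI impI)
  fix n k :: nat
  assume "n \<ge> 1" "k \<ge> 1"
  then obtain q where k: "k = Suc q"
    by (cases k) auto
  have "bp15 (complete_graph (n ^ (2 * k - 1))) \<le> (2 * q + 1) * n ^ k"
    using bp15_complete_graph_le[OF \<open>n \<ge> 1\<close>, of q] by (simp add: k)
  also have "\<dots> \<le> 2 * k * n ^ k"
    by (intro mult_right_mono) (simp_all add: k)
  finally have "real (bp15 (complete_graph (n ^ (2 * k - 1)))) \<le> real (2 * k * n ^ k)"
    by (rule of_nat_mono)
  then show "real (bp15 (complete_graph (n ^ (2 * k - 1)))) \<le> 2 * real k * real n ^ k"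
    by simp
qed simp

end
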